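(* Fix a mode theory $\mathcal{M}$ (a strict 2-category) and consider the multimodal natural deduction system described in the context. The following lock-weakening rule is admissible: for all pre-contexts $\Gamma,\Delta$, parallel modalities $\mu,\nu : n \to m$, transformation $\alpha : \mu\Rightarrow\nu$, mode $p$ and formula $\varphi$, if $\Gamma.\mathsf{lock}_\mu, \Delta \vdash \varphi\ @\,p$ is derivable, then $\Gamma.\mathsf{lock}_\nu, \Delta \vdash \varphi\ @\,p$ is derivable.
   Context: A mode theory is a strict 2-category $\mathcal{M}$. Its objects are called modes ($m,n,o,p,\dots$); its 1-cells $\mu : n \to m$ are called modalities, with composition $\mu\circ\nu : o \to m$ for $\nu : o\to n$, $\mu : n \to m$, and identities $1_m : m \to m$; its 2-cells $\alpha : \mu \Rightarrow \nu$ (between parallel modalities) are called transformations, with vertical composition $\beta\circ\alpha$, identities $1_\mu$, and horizontal composition $\alpha * \beta : \mu\circ\theta \Rightarrow \nu\circ\xi$ for $\alpha:\mu\Rightarrow\nu$, $\beta : \theta\Rightarrow\xi$, satisfying the strict 2-category laws. Formulas. Pre-formulas: $\varphi,\psi ::= p_i \mid \bot \mid \top \mid \varphi\lor\psi \mid \varphi\land\psi \mid (\mu\mid\varphi)\to\psi \mid \langle\mu\mid\varphi\rangle$. The judgement "$\varphi$ wff $@\,m$" is generated by: $p_i,\top,\bot$ are wff at every mode; if $\varphi,\psi$ wff $@\,m$ then so are $\varphi\land\psi$, $\varphi\lor\psi$; if $\mu:n\to m$, $\varphi$ wff $@\,n$ and $\psi$ wff $@\,m$ then $(\mu\mid\varphi)\to\psi$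 wff $@\,m$; if $\varphi$ wff $@\,n$ and $\mu:n\to m$ then $\langle\mu\mid\varphi\rangle$ wff $@\,m$. Contexts. Pre-contexts: $\Gamma ::= \cdot \mid \Gamma, (\mu\mid\varphi) \mid \Gamma.\mathsf{lock}_\mu$. The judgement "$\Gamma$ ctx $@\,m$" is generated by: $\cdot$ ctx $@\,m$; if $\Gamma$ ctx $@\,m$, $\mu : n\to m$ and $\varphi$ wff $@\,n$ then $\Gamma,(\mu\mid\varphi)$ ctx $@\,m$; if $\Gamma$ ctx $@\,m$ and $\mu : n \to m$ then $\Gamma.\mathsf{lock}_\mu$ ctx $@\,n$. Contexts are identified modulo $\Gamma.\mathsf{lock}_{1_m} = \Gamma$ and $\Gamma.\mathsf{lock}_\mu.\mathsf{lock}_\nu = \Gamma.\mathsf{lock}_{\mu\circ\nu}$. $\Gamma,\Delta$ denotes concatenation of pre-contexts. Define $|\cdot| = 1$, $|\Gamma,(\mu\mid\varphi)| = |\Gamma|$, $|\Gamma.\mathsf{lock}_\mu| = |\Gamma|\circ\mu$. Derivability of $\Gamma\vdash\varphi\ @\,m$ is generated by the rules: (var) if $\mu : n\to m$ and $\alpha : \mu\Rightarrow |\Delta|$ then $\Gamma,(\mu\mid\varphi),\Delta \vdash \varphi\ @\,n$; ($\top$) $\Gamma\vdash\top\ @\,m$; ($\bot$E) from $\Gamma\vdash\bot\ @\,m$ infer $\Gamma\vdash\varphi\ @\,m$; ($\land$I) from $\Gamma\vdash\varphi$ and $\Gamma\vdash\psi$ infer $\Gamma\vdash\varphi\land\psi$;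 ($\land$E) from $\Gamma\vdash\varphi_1\land\varphi_2$ infer $\Gamma\vdash\varphi_i$; ($\lor$I) from $\Gamma\vdash\varphi_i$ infer $\Gamma\vdash\varphi_1\lor\varphi_2$; ($\lor$E) from $\Gamma\vdash\varphi\lor\psi$, $\Gamma,(1\mid\varphi)\vdash C$, $\Gamma,(1\mid\psi)\vdash C$ infer $\Gamma\vdash C$ (all at the same mode); ($\to$I) from $\Gamma,(\mu\mid\varphi)\vdash\psi\ @\,m$ infer $\Gamma\vdash(\mu\mid\varphi)\to\psi\ @\,m$; ($\to$E) if $\mu:n\to m$, from $\Gamma\vdash(\mu\mid\varphi)\to\psi\ @\,m$ and $\Gamma.\mathsf{lock}_\mu\vdash\varphi\ @\,n$ infer $\Gamma\vdash\psi\ @\,m$; (modI) if $\mu:n\to m$, from $\Gamma.\mathsf{lock}_\mu\vdash\varphi\ @\,n$ infer $\Gamma\vdash\langle\mu\mid\varphi\rangle\ @\,m$; (modE) if $\nu:o\to n$, $\mu:n\to m$, from $\Gamma.\mathsf{lock}_\mu\vdash\langle\nu\mid\varphi\rangle\ @\,n$ and $\Gamma,(\mu\circ\nu\mid\varphi)\vdash\psi\ @\,m$ infer $\Gamma\vdash\psi\ @\,m$. A rule is admissible if whenever its premises are derivable, so is its conclusion. *)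

theory Defs
  imports Main
begin

record ('o, 'm, 't) mode_theory =
  modes :: "'o set"
  modalities :: "'m set"
  transformations :: "'t set"
  src :: "'m \<Rightarrow> 'o"
  tgt :: "'m \<Rightarrow> 'o"
  one :: "'o \<Rightarrow> 'm" ("\<one>\<index>")
  comp1 :: "'m \<Rightarrow> 'm \<Rightarrow> 'm" (infixl "\<odot>\<index>" 70)
  src2 :: "'t \<Rightarrow> 'm"
  tgt2 :: "'t \<Rightarrow> 'm"
  one2 :: "'m \<Rightarrow> 't"
  vcomp :: "'t \<Rightarrow> 't \<Rightarrow> 't" (infixl "\<cdot>\<index>" 70)
  hcomp :: "'t \<Rightarrow> 't \<Rightarrow> 't" (infixl "\<star>\<index>" 75)

definition modality :: "('o, 'm, 't, 'x) mode_theory_scheme \<Rightarrow> 'm \<Rightarrow> 'o \<Rightarrow> 'o \<Rightarrow> bool" where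
  "modality M \<mu> n m \<longleftrightarrow> \<mu> \<in> modalities M \<and> src M \<mu> = n \<and> tgt M \<mu> = m"

definition transformation :: "('o, 'm, 't, 'x) mode_theory_scheme \<Rightarrow> 't \<Rightarrow> 'm \<Rightarrow> 'm \<Rightarrow> bool" where
  "transformation M \<alpha> \<mu> \<nu> \<longleftrightarrow> \<alpha> \<in> transformations M \<and> src2 M \<alpha> = \<mu> \<and> tgt2 M \<alpha> = \<nu>"

text \<open>Both \<open>\<mu> \<odot> \<nu>\<close> and \<open>\<beta> \<cdot> \<alpha>\<close> are written in applicative order: the right argument comes first.\<close>

locale strict_two_category =
  fixes M :: "('o, 'm, 't, 'x) mode_theory_scheme" (structure)
  assumes modality_modes: "modality M \<mu> n m \<Longrightarrow> n \<in> modes M \<and> m \<in> modes M"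
    and one_modality: "m \<in> modes M \<Longrightarrow> modality M (\<one> m) m m"
    and comp1_modality:
      "\<lbrakk>modality M \<mu> n m; modality M \<nu> o' n\<rbrakk> \<Longrightarrow> modality M (\<mu> \<odot> \<nu>) o' m"
    and comp1_one_left: "modality M \<mu> n m \<Longrightarrow> \<one> m \<odot> \<mu> = \<mu>"
    and comp1_one_right: "modality M \<mu> n m \<Longrightarrow> \<mu> \<odot> \<one> n = \<mu>"
    and comp1_assoc:
      "\<lbrakk>modality M \<mu> n m; modality M \<nu> o' n; modality M \<xi> p o'\<rbrakk>
        \<Longrightarrow> (\<mu> \<odot> \<nu>) \<odot> \<xi> = \<mu> \<odot> (\<nu> \<odot> \<xi>)"
    and transformation_parallel:
      "transformation M \<alpha> \<mu> \<nu> \<Longrightarrow> \<exists>n m. modality M \<mu> n m \<and> modality M \<nu> n m"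
    and one2_transformation: "modality M \<mu> n m \<Longrightarrow> transformation M (one2 M \<mu>) \<mu> \<mu>"
    and vcomp_transformation:
      "\<lbrakk>transformation M \<alpha> \<mu> \<nu>; transformation M \<beta> \<nu> \<xi>\<rbrakk>
        \<Longrightarrow> transformation M (\<beta> \<cdot> \<alpha>) \<mu> \<xi>"
    and vcomp_one_left: "transformation M \<alpha> \<mu> \<nu> \<Longrightarrow> one2 M \<nu> \<cdot> \<alpha> = \<alpha>"
    and vcomp_one_right: "transformation M \<alpha> \<mu> \<nu> \<Longrightarrow> \<alpha> \<cdot> one2 M \<mu> = \<alpha>"
    and vcomp_assoc:
      "\<lbrakk>transformation M \<alpha> \<mu> \<nu>; transformation M \<beta> \<nu> \<xi>; transformation M \<gamma> \<xi> \<zeta>\<rbrakk>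
        \<Longrightarrow> (\<gamma> \<cdot> \<beta>) \<cdot> \<alpha> = \<gamma> \<cdot> (\<beta> \<cdot> \<alpha>)"
    and hcomp_transformation:
      "\<lbrakk>transformation M \<alpha> \<mu> \<nu>; transformation M \<beta> \<theta> \<xi>; modality M \<mu> n m; modality M \<theta> o' n\<rbrakk>
        \<Longrightarrow> transformation M (\<alpha> \<star> \<beta>) (\<mu> \<odot> \<theta>) (\<nu> \<odot> \<xi>)"
    and hcomp_one_left:
      "\<lbrakk>transformation M \<alpha> \<mu> \<nu>; modality M \<mu> n m\<rbrakk> \<Longrightarrow> one2 M (\<one> m) \<star> \<alpha> = \<alpha>"
    and hcomp_one_right:
      "\<lbrakk>transformation M \<alpha> \<mu> \<nu>; modality M \<mu> n m\<rbrakk> \<Longrightarrow> \<alpha> \<star> one2 M (\<one> n) = \<alpha>"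
    and hcomp_assoc:
      "\<lbrakk>transformation M \<alpha> \<mu> \<mu>'; transformation M \<beta> \<nu> \<nu>'; transformation M \<gamma> \<xi> \<xi>';
        modality M \<mu> n m; modality M \<nu> o' n; modality M \<xi> p o'\<rbrakk>
        \<Longrightarrow> (\<alpha> \<star> \<beta>) \<star> \<gamma> = \<alpha> \<star> (\<beta> \<star> \<gamma>)"
    and hcomp_one2:
      "\<lbrakk>modality M \<mu> n m; modality M \<nu> o' n\<rbrakk>
        \<Longrightarrow> one2 M \<mu> \<star> one2 M \<nu> = one2 M (\<mu> \<odot> \<nu>)"
    and interchange:
      "\<lbrakk>transformation M \<alpha> \<mu> \<mu>'; transformation M \<beta> \<mu>' \<mu>'';
        transformation M \<gamma> \<nu> \<nu>'; transformation M \<delta> \<nu>' \<nu>'';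
        modality M \<mu> n m; modality M \<nu> o' n\<rbrakk>
        \<Longrightarrow> (\<beta> \<cdot> \<alpha>) \<star> (\<delta> \<cdot> \<gamma>) = (\<beta> \<star> \<delta>) \<cdot> (\<alpha> \<star> \<gamma>)"

datatype 'm form =
    Var nat
  | Bot
  | Top
  | Or "'m form" "'m form"
  | And "'m form" "'m form"
  | Imp 'm "'m form" "'m form" \<comment> \<open>\<open>Imp \<mu> \<phi> \<psi>\<close> is \<open>(\<mu> | \<phi>) \<rightarrow> \<psi>\<close>\<close>
  | Mod 'm "'m form"

inductive wff :: "('o, 'm, 't, 'x) mode_theory_scheme \<Rightarrow> 'm form \<Rightarrow> 'o \<Rightarrow> bool"
  for M (structure) where
  wff_Var: "m \<in> modes M \<Longrightarrow> wff M (Var i) m"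
| wff_Bot: "m \<in> modes M \<Longrightarrow> wff M Bot m"
| wff_Top: "m \<in> modes M \<Longrightarrow> wff M Top m"
| wff_Or: "\<lbrakk>wff M \<phi> m; wff M \<psi> m\<rbrakk> \<Longrightarrow> wff M (Or \<phi> \<psi>) m"
| wff_And: "\<lbrakk>wff M \<phi> m; wff M \<psi> m\<rbrakk> \<Longrightarrow> wff M (And \<phi> \<psi>) m"
| wff_Imp: "\<lbrakk>modality M \<mu> n m; wff M \<phi> n; wff M \<psi> m\<rbrakk> \<Longrightarrow> wff M (Imp \<mu> \<phi> \<psi>) m"
| wff_Mod: "\<lbrakk>wff M \<phi> n; modality M \<mu> n m\<rbrakk> \<Longrightarrow> wff M (Mod \<mu> \<phi>) m"

datatype 'm prectx =
    Emp
  | Ext "'m prectx" 'm "'m form"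
  | Lock "'m prectx" 'm

primrec cat :: "'m prectx \<Rightarrow> 'm prectx \<Rightarrow> 'm prectx" where
  "cat \<Gamma> Emp = \<Gamma>"
| "cat \<Gamma> (Ext \<Delta> \<mu> \<phi>) = Ext (cat \<Gamma> \<Delta>) \<mu> \<phi>"
| "cat \<Gamma> (Lock \<Delta> \<mu>) = Lock (cat \<Gamma> \<Delta>) \<mu>"

inductive ctx :: "('o, 'm, 't, 'x) mode_theory_scheme \<Rightarrow> 'm prectx \<Rightarrow> 'o \<Rightarrow> bool"
  for M (structure) where
  ctx_Emp: "m \<in> modes M \<Longrightarrow> ctx M Emp m"
| ctx_Ext: "\<lbrakk>ctx M \<Gamma> m; modality M \<mu> n m; wff M \<phi> n\<rbrakk> \<Longrightarrow> ctx M (Ext \<Gamma> \<mu> \<phi>) m"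
| ctx_Lock: "\<lbrakk>ctx M \<Gamma> m; modality M \<mu> n m\<rbrakk> \<Longrightarrow> ctx M (Lock \<Gamma> \<mu>) n"

text \<open>
  The empty pre-context exists at every mode, so \<open>|\<Delta>|\<close> is relative to the mode \<open>m\<close> at which
  \<open>\<Delta>\<close> starts: \<open>locks M m \<Delta>\<close> is a modality into \<open>m\<close>.
\<close>

primrec locks :: "('o, 'm, 't, 'x) mode_theory_scheme \<Rightarrow> 'o \<Rightarrow> 'm prectx \<Rightarrow> 'm" where
  "locks M m Emp = \<one>\<^bsub>M\<^esub> m"
| "locks M m (Ext \<Gamma> \<mu> \<phi>) = locks M m \<Gamma>"
| "locks M m (Lock \<Gamma> \<mu>) = locks M m \<Gamma> \<odot>\<^bsub>M\<^esub> \<mu>"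

text \<open>
  The identification of contexts is the congruence generated by the two lock equations. It relates
  contexts at a common mode, so that \<open>Lock \<Gamma> (\<one> m)\<close> is equated with \<open>\<Gamma>\<close> only when \<open>\<Gamma>\<close>
  lives at \<open>m\<close>.
\<close>

inductive ctx_eq ::
  "('o, 'm, 't, 'x) mode_theory_scheme \<Rightarrow> 'm prectx \<Rightarrow> 'm prectx \<Rightarrow> 'o \<Rightarrow> bool"
  for M (structure) where
  ctx_eq_refl: "ctx M \<Gamma> m \<Longrightarrow> ctx_eq M \<Gamma> \<Gamma> m"
| ctx_eq_sym: "ctx_eq M \<Gamma> \<Delta> m \<Longrightarrow> ctx_eq M \<Delta> \<Gamma> m"
| ctx_eq_trans: "\<lbrakk>ctx_eq M \<Gamma> \<Delta> m; ctx_eq M \<Delta> \<Theta> m\<rbrakk> \<Longrightarrow> ctx_eq M \<Gamma> \<Theta> m"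
| ctx_eq_Ext:
    "\<lbrakk>ctx_eq M \<Gamma> \<Delta> m; modality M \<mu> n m; wff M \<phi> n\<rbrakk>
      \<Longrightarrow> ctx_eq M (Ext \<Gamma> \<mu> \<phi>) (Ext \<Delta> \<mu> \<phi>) m"
| ctx_eq_Lock:
    "\<lbrakk>ctx_eq M \<Gamma> \<Delta> m; modality M \<mu> n m\<rbrakk> \<Longrightarrow> ctx_eq M (Lock \<Gamma> \<mu>) (Lock \<Delta> \<mu>) n"
| ctx_eq_Lock_one: "ctx M \<Gamma> m \<Longrightarrow> ctx_eq M (Lock \<Gamma> (\<one> m)) \<Gamma> m"
| ctx_eq_Lock_comp:
    "\<lbrakk>ctx M \<Gamma> m; modality M \<mu> n m; modality M \<nu> o' n\<rbrakk>
      \<Longrightarrow> ctx_eq M (Lock (Lock \<Gamma> \<mu>) \<nu>) (Lock \<Gamma> (\<mu> \<odot> \<nu>)) o'"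

text \<open>
  Rule \<open>conv\<close> expresses that derivability is a property of contexts up to \<open>ctx_eq\<close>. The premises
  \<open>ctx\<close> and \<open>wff\<close> are the presuppositions of the judgement; they are stated only where they
  do not already follow from the other premises.
\<close>

inductive derivable ::
  "('o, 'm, 't, 'x) mode_theory_scheme \<Rightarrow> 'm prectx \<Rightarrow> 'm form \<Rightarrow> 'o \<Rightarrow> bool"
  for M (structure) where
  conv: "\<lbrakk>ctx_eq M \<Gamma> \<Delta> m; derivable M \<Gamma> \<phi> m\<rbrakk> \<Longrightarrow> derivable M \<Delta> \<phi> m"
| var:
    "\<lbrakk>ctx M (cat (Ext \<Gamma> \<mu> \<phi>) \<Delta>) n; modality M \<mu> n m; transformation M \<alpha> \<mu> (locks M m \<Delta>)\<rbrakk>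
      \<Longrightarrow> derivable M (cat (Ext \<Gamma> \<mu> \<phi>) \<Delta>) \<phi> n"
| TopI: "ctx M \<Gamma> m \<Longrightarrow> derivable M \<Gamma> Top m"
| BotE: "\<lbrakk>derivable M \<Gamma> Bot m; wff M \<phi> m\<rbrakk> \<Longrightarrow> derivable M \<Gamma> \<phi> m"
| AndI: "\<lbrakk>derivable M \<Gamma> \<phi> m; derivable M \<Gamma> \<psi> m\<rbrakk> \<Longrightarrow> derivable M \<Gamma> (And \<phi> \<psi>) m"
| AndE1: "derivable M \<Gamma> (And \<phi> \<psi>) m \<Longrightarrow> derivable M \<Gamma> \<phi> m"
| AndE2: "derivable M \<Gamma> (And \<phi> \<psi>) m \<Longrightarrow> derivable M \<Gamma> \<psi> m"
| OrI1: "\<lbrakk>derivable M \<Gamma> \<phi> m; wff M \<psi> m\<rbrakk> \<Longrightarrow> derivable M \<Gamma> (Or \<phi> \<psi>) m"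
| OrI2: "\<lbrakk>derivable M \<Gamma> \<psi> m; wff M \<phi> m\<rbrakk> \<Longrightarrow> derivable M \<Gamma> (Or \<phi> \<psi>) m"
| OrE:
    "\<lbrakk>derivable M \<Gamma> (Or \<phi> \<psi>) m; derivable M (Ext \<Gamma> (\<one> m) \<phi>) \<chi> m;
      derivable M (Ext \<Gamma> (\<one> m) \<psi>) \<chi> m\<rbrakk> \<Longrightarrow> derivable M \<Gamma> \<chi> m"
| ImpI: "derivable M (Ext \<Gamma> \<mu> \<phi>) \<psi> m \<Longrightarrow> derivable M \<Gamma> (Imp \<mu> \<phi> \<psi>) m"
| ImpE:
    "\<lbrakk>modality M \<mu> n m; derivable M \<Gamma> (Imp \<mu> \<phi> \<psi>) m; derivable M (Lock \<Gamma> \<mu>) \<phi> n\<rbrakk>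
      \<Longrightarrow> derivable M \<Gamma> \<psi> m"
| ModI:
    "\<lbrakk>modality M \<mu> n m; derivable M (Lock \<Gamma> \<mu>) \<phi> n\<rbrakk> \<Longrightarrow> derivable M \<Gamma> (Mod \<mu> \<phi>) m"
| ModE:
    "\<lbrakk>modality M \<nu> o' n; modality M \<mu> n m; derivable M (Lock \<Gamma> \<mu>) (Mod \<nu> \<phi>) n;
      derivable M (Ext \<Gamma> (\<mu> \<odot> \<nu>) \<phi>) \<psi> m\<rbrakk> \<Longrightarrow> derivable M \<Gamma> \<psi> m"

end

theory Submission
  imports Defs
begin

text \<open>
  Put \<open>\<Gamma>\<close> below \<open>\<Gamma>'\<close> when every hypothesis \<open>(\<mu> | \<phi>)\<close> of \<open>\<Gamma>\<close> also occurs in \<open>\<Gamma>'\<close>, and the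
  composites \<open>\<kappa>\<close> and \<open>\<kappa>'\<close> of the locks to the right of the two occurrences are related by a
  transformation \<open>\<kappa> \<Rightarrow> \<kappa>'\<close>. This is invariant under the identification of contexts, because the
  unit and associativity laws of modalities hold strictly, so that the composites do not change.
  Derivability is monotone: the variable rule only needs some transformation \<open>\<mu> \<Rightarrow> \<kappa>\<close>, which
  composes with \<open>\<kappa> \<Rightarrow> \<kappa>'\<close>, and the other rules only need stability under extensions and, by
  whiskering, under locks. Replacing a lock \<open>\<mu>\<close> by \<open>\<nu>\<close> along \<open>\<alpha> : \<mu> \<Rightarrow> \<nu>\<close> goes up, again by
  whiskering.
\<close>

inductive_simps ctx_Ext_iff: "ctx M (Ext \<Gamma> \<mu> \<phi>) m"
inductive_simps ctx_Lock_iff: "ctx M (Lock \<Gamma> \<mu>) n"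

lemma ctx_LockD: "\<lbrakk>ctx M (Lock \<Gamma> \<mu>) n; modality M \<mu> n m\<rbrakk> \<Longrightarrow> ctx M \<Gamma> m"
  by (auto simp: ctx_Lock_iff modality_def)

context strict_two_category
begin

lemma ctx_mode: "ctx M \<Gamma> m \<Longrightarrow> m \<in> modes M"
  by (induction rule: ctx.induct) (auto dest: modality_modes)

lemma ctx_eq_imp_ctx: "ctx_eq M \<Gamma> \<Delta> m \<Longrightarrow> ctx M \<Gamma> m \<and> ctx M \<Delta> m"
  by (induction rule: ctx_eq.induct)
    (blast intro: ctx.intros one_modality comp1_modality dest: ctx_mode)+

lemma derivable_imp_ctx: "derivable M \<Gamma> \<phi> m \<Longrightarrow> ctx M \<Gamma> m"
  by (induction rule: derivable.induct) (auto simp: ctx_Ext_iff dest: ctx_eq_imp_ctx ctx_LockD)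

end

text \<open>
  In \<open>(\<mu>, \<phi>, \<kappa>) \<in> locked_hyps M \<Gamma>\<close>, the modality \<open>\<kappa>\<close> is \<open>|\<Delta>|\<close> for the part \<open>\<Delta>\<close> of \<open>\<Gamma>\<close>
  to the right of the hypothesis \<open>(\<mu> | \<phi>)\<close>.
\<close>

primrec locked_hyps ::
  "('o, 'm, 't, 'x) mode_theory_scheme \<Rightarrow> 'm prectx \<Rightarrow> ('m \<times> 'm form \<times> 'm) set" where
  "locked_hyps M Emp = {}"
| "locked_hyps M (Ext \<Gamma> \<mu> \<phi>) = insert (\<mu>, \<phi>, \<one>\<^bsub>M\<^esub> (tgt M \<mu>)) (locked_hyps M \<Gamma>)"
| "locked_hyps M (Lock \<Gamma> \<nu>) = {(\<mu>, \<phi>, \<kappa> \<odot>\<^bsub>M\<^esub> \<nu>) | \<mu> \<phi> \<kappa>. (\<mu>, \<phi>, \<kappa>) \<in> locked_hyps M \<Gamma>}"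

lemma locked_hyps_cat_Ext: "(\<mu>, \<phi>, locks M (tgt M \<mu>) \<Delta>) \<in> locked_hyps M (cat (Ext \<Gamma> \<mu> \<phi>) \<Delta>)"
  by (induction \<Delta>) auto

lemma locked_hyps_imp_cat_Ext:
  "(\<mu>, \<phi>, \<kappa>) \<in> locked_hyps M \<Gamma> \<Longrightarrow>
    \<exists>\<Gamma>' \<Delta>. \<Gamma> = cat (Ext \<Gamma>' \<mu> \<phi>) \<Delta> \<and> \<kappa> = locks M (tgt M \<mu>) \<Delta>"
proof (induction \<Gamma> arbitrary: \<kappa>)
  case Emp
  then show ?case by simp
next
  case (Ext \<Gamma> \<nu> \<psi>)
  then consider "\<nu> = \<mu>" "\<psi> = \<phi>" "\<kappa> = locks M (tgt M \<mu>) Emp" | "(\<mu>, \<phi>, \<kappa>) \<in> locked_hyps M \<Gamma>"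
    by auto
  then show ?case
    by cases (metis cat.simps(1), metis Ext.IH cat.simps(2) locks.simps(2))
next
  case (Lock \<Gamma> \<nu>)
  then obtain \<theta> where "(\<mu>, \<phi>, \<theta>) \<in> locked_hyps M \<Gamma>" "\<kappa> = \<theta> \<odot>\<^bsub>M\<^esub> \<nu>" by auto
  then show ?case by (metis Lock.IH cat.simps(3) locks.simps(3))
qed

context strict_two_category
begin

lemma locked_hyps_modality:
  "\<lbrakk>ctx M \<Gamma> n; (\<mu>, \<phi>, \<kappa>) \<in> locked_hyps M \<Gamma>\<rbrakk> \<Longrightarrow> modality M \<kappa> n (tgt M \<mu>)"
proof (induction arbitrary: \<kappa> rule: ctx.induct)
  case (ctx_Ext \<Gamma> m \<nu> n \<psi>)
  then show ?case using ctx_mode one_modality by (auto simp: modality_def)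
next
  case (ctx_Lock \<Gamma> m \<nu> n)
  then show ?case by (auto intro: comp1_modality)
qed simp

lemma ctx_eq_imp_locked_hyps_eq: "ctx_eq M \<Gamma> \<Delta> m \<Longrightarrow> locked_hyps M \<Gamma> = locked_hyps M \<Delta>"
proof (induction rule: ctx_eq.induct)
  case (ctx_eq_Lock_one \<Gamma> m)
  then have "\<kappa> \<odot> \<one> m = \<kappa>" if "(\<mu>, \<phi>, \<kappa>) \<in> locked_hyps M \<Gamma>" for \<mu> \<phi> \<kappa>
    using that locked_hyps_modality comp1_one_right by blast
  then show ?case by (force simp: set_eq_iff)
next
  case (ctx_eq_Lock_comp \<Gamma> m \<nu> n \<xi> o')
  then have "\<kappa> \<odot> \<nu> \<odot> \<xi> = \<kappa> \<odot> (\<nu> \<odot> \<xi>)" if "(\<mu>, \<phi>, \<kappa>) \<in> locked_hyps M \<Gamma>" for \<mu> \<phi> \<kappa>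
    using that locked_hyps_modality comp1_assoc by blast
  then show ?case by (simp add: set_eq_iff) metis
qed simp_all

lemma derivable_locked_hyp:
  assumes "ctx M \<Gamma> n" and "(\<mu>, \<phi>, \<kappa>) \<in> locked_hyps M \<Gamma>" and "transformation M \<alpha> \<mu> \<kappa>"
  shows "derivable M \<Gamma> \<phi> n"
proof -
  obtain \<Gamma>' \<Delta> where \<Gamma>: "\<Gamma> = cat (Ext \<Gamma>' \<mu> \<phi>) \<Delta>" and \<kappa>: "\<kappa> = locks M (tgt M \<mu>) \<Delta>"
    using locked_hyps_imp_cat_Ext[OF assms(2)] by blast
  have "modality M \<kappa> n (tgt M \<mu>)"
    using locked_hyps_modality assms(1,2) by blast
  then have \<mu>: "modality M \<mu> n (tgt M \<mu>)"
    using transformation_parallel[OF assms(3)] by (auto simp: modality_def)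
  from assms(1) \<mu> assms(3) show ?thesis unfolding \<Gamma> \<kappa> by (rule derivable.var)
qed

end

definition ctx_le ::
  "('o, 'm, 't, 'x) mode_theory_scheme \<Rightarrow> 'm prectx \<Rightarrow> 'm prectx \<Rightarrow> 'o \<Rightarrow> bool" where
  "ctx_le M \<Gamma> \<Gamma>' m \<longleftrightarrow> ctx M \<Gamma> m \<and> ctx M \<Gamma>' m \<and>
    (\<forall>\<mu> \<phi> \<kappa>. (\<mu>, \<phi>, \<kappa>) \<in> locked_hyps M \<Gamma> \<longrightarrow>
      (\<exists>\<kappa>' \<alpha>. (\<mu>, \<phi>, \<kappa>') \<in> locked_hyps M \<Gamma>' \<and> transformation M \<alpha> \<kappa> \<kappa>'))"

lemma ctx_leI:
  assumes "ctx M \<Gamma> m" and "ctx M \<Gamma>' m"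
    and "\<And>\<mu> \<phi> \<kappa>. (\<mu>, \<phi>, \<kappa>) \<in> locked_hyps M \<Gamma> \<Longrightarrow>
      \<exists>\<kappa>' \<alpha>. (\<mu>, \<phi>, \<kappa>') \<in> locked_hyps M \<Gamma>' \<and> transformation M \<alpha> \<kappa> \<kappa>'"
  shows "ctx_le M \<Gamma> \<Gamma>' m"
  using assms unfolding ctx_le_def by blast

lemma ctx_leE:
  assumes "ctx_le M \<Gamma> \<Gamma>' m" and "(\<mu>, \<phi>, \<kappa>) \<in> locked_hyps M \<Gamma>"
  obtains \<kappa>' \<alpha> where "(\<mu>, \<phi>, \<kappa>') \<in> locked_hyps M \<Gamma>'" "transformation M \<alpha> \<kappa> \<kappa>'"
  using assms unfolding ctx_le_def by blast

lemma ctx_le_imp_ctx: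
  assumes "ctx_le M \<Gamma> \<Gamma>' m"
  shows "ctx M \<Gamma> m" and "ctx M \<Gamma>' m"
  using assms by (simp_all add: ctx_le_def)

context strict_two_category
begin

lemma ctx_eq_ctx_le_trans:
  assumes "ctx_eq M \<Gamma> \<Delta> m" and "ctx_le M \<Delta> \<Gamma>' m"
  shows "ctx_le M \<Gamma> \<Gamma>' m"
  using assms(2) ctx_eq_imp_ctx[OF assms(1)] ctx_eq_imp_locked_hyps_eq[OF assms(1)]
  by (simp add: ctx_le_def)

lemma ctx_le_Ext:
  assumes "ctx_le M \<Gamma> \<Gamma>' m" and "ctx M (Ext \<Gamma> \<mu> \<phi>) m"
  shows "ctx_le M (Ext \<Gamma> \<mu> \<phi>) (Ext \<Gamma>' \<mu> \<phi>) m"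
proof (rule ctx_leI)
  show "ctx M (Ext \<Gamma>' \<mu> \<phi>) m"
    using assms ctx_le_imp_ctx by (auto simp: ctx_Ext_iff)
next
  fix \<xi> \<psi> \<kappa>
  assume "(\<xi>, \<psi>, \<kappa>) \<in> locked_hyps M (Ext \<Gamma> \<mu> \<phi>)"
  then consider (new) "\<xi> = \<mu>" "\<psi> = \<phi>" "\<kappa> = \<one> (tgt M \<mu>)" | (old) "(\<xi>, \<psi>, \<kappa>) \<in> locked_hyps M \<Gamma>"
    by auto
  then show "\<exists>\<kappa>' \<alpha>. (\<xi>, \<psi>, \<kappa>') \<in> locked_hyps M (Ext \<Gamma>' \<mu> \<phi>) \<and> transformation M \<alpha> \<kappa> \<kappa>'"
  proof cases
    case new
    then have "modality M \<kappa> m (tgt M \<mu>)"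
      by (intro locked_hyps_modality[OF assms(2)]) auto
    then have "transformation M (one2 M \<kappa>) \<kappa> \<kappa>"
      by (rule one2_transformation)
    with new show ?thesis by auto
  next
    case old
    then show ?thesis using assms(1) by (auto elim!: ctx_leE)
  qed
qed fact

lemma ctx_le_Lock:
  assumes "ctx_le M \<Gamma> \<Gamma>' m" and "modality M \<mu> n m"
  shows "ctx_le M (Lock \<Gamma> \<mu>) (Lock \<Gamma>' \<mu>) n"
proof (rule ctx_leI)
  fix \<xi> \<psi> \<kappa>
  assume "(\<xi>, \<psi>, \<kappa>) \<in> locked_hyps M (Lock \<Gamma> \<mu>)"
  then obtain \<theta> where \<theta>: "(\<xi>, \<psi>, \<theta>) \<in> locked_hyps M \<Gamma>" and \<kappa>: "\<kappa> = \<theta> \<odot> \<mu>" by auto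
  from assms(1) \<theta> obtain \<theta>' \<alpha>
    where \<theta>': "(\<xi>, \<psi>, \<theta>') \<in> locked_hyps M \<Gamma>'" and \<alpha>: "transformation M \<alpha> \<theta> \<theta>'" by (rule ctx_leE)
  have "modality M \<theta> m (tgt M \<xi>)"
    using ctx_le_imp_ctx(1)[OF assms(1)] \<theta> by (rule locked_hyps_modality)
  then have "transformation M (\<alpha> \<star> one2 M \<mu>) \<kappa> (\<theta>' \<odot> \<mu>)"
    unfolding \<kappa> using \<alpha> assms(2) hcomp_transformation one2_transformation by blast
  with \<theta>' show "\<exists>\<kappa>' \<alpha>. (\<xi>, \<psi>, \<kappa>') \<in> locked_hyps M (Lock \<Gamma>' \<mu>) \<and> transformation M \<alpha> \<kappa> \<kappa>'"
    by auto
qed (use assms in \<open>blast intro: ctx_Lock dest: ctx_le_imp_ctx\<close>)+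

lemma ctx_le_Lock_transformation:
  assumes "transformation M \<alpha> \<mu> \<nu>" and "ctx M (Lock \<Gamma> \<mu>) n"
  shows "ctx_le M (Lock \<Gamma> \<mu>) (Lock \<Gamma> \<nu>) n"
proof -
  obtain m where \<Gamma>: "ctx M \<Gamma> m" and \<mu>: "modality M \<mu> n m" and \<nu>: "modality M \<nu> n m"
    using transformation_parallel[OF assms(1)] assms(2)
    by (auto simp: ctx_Lock_iff modality_def)
  show ?thesis
  proof (rule ctx_leI)
    fix \<xi> \<psi> \<kappa>
    assume "(\<xi>, \<psi>, \<kappa>) \<in> locked_hyps M (Lock \<Gamma> \<mu>)"
    then obtain \<theta> where \<theta>: "(\<xi>, \<psi>, \<theta>) \<in> locked_hyps M \<Gamma>" and \<kappa>: "\<kappa> = \<theta> \<odot> \<mu>" by auto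
    have "modality M \<theta> m (tgt M \<xi>)"
      using \<Gamma> \<theta> locked_hyps_modality by blast
    then have "transformation M (one2 M \<theta> \<star> \<alpha>) \<kappa> (\<theta> \<odot> \<nu>)"
      unfolding \<kappa> using \<mu> assms(1) hcomp_transformation one2_transformation by blast
    with \<theta> show "\<exists>\<kappa>' \<alpha>. (\<xi>, \<psi>, \<kappa>') \<in> locked_hyps M (Lock \<Gamma> \<nu>) \<and> transformation M \<alpha> \<kappa> \<kappa>'"
      by auto
  qed (use \<Gamma> \<mu> \<nu> in \<open>blast intro: ctx_Lock\<close>)+
qed

lemma ctx_le_cat:
  assumes "\<And>m. ctx M \<Gamma> m \<Longrightarrow> ctx_le M \<Gamma> \<Gamma>' m" and "ctx M (cat \<Gamma> \<Delta>) p"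
  shows "ctx_le M (cat \<Gamma> \<Delta>) (cat \<Gamma>' \<Delta>) p"
  using assms(2)
proof (induction \<Delta> arbitrary: p)
  case Emp
  then show ?case using assms(1) by simp
next
  case (Ext \<Delta> \<xi> \<psi>)
  then show ?case by (simp add: ctx_le_Ext ctx_Ext_iff)
next
  case (Lock \<Delta> \<xi>)
  then show ?case by (auto simp: ctx_Lock_iff intro: ctx_le_Lock)
qed

lemma derivable_mono:
  assumes "derivable M \<Gamma> \<phi> m" and "ctx_le M \<Gamma> \<Gamma>' m"
  shows "derivable M \<Gamma>' \<phi> m"
  using assms
proof (induction arbitrary: \<Gamma>' rule: derivable.induct)
  case (conv \<Gamma> \<Delta> m \<phi>)
  then show ?case using ctx_eq_ctx_le_trans by blast
next
  case (var \<Gamma> \<mu> \<phi> \<Delta> n m \<alpha>)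
  then have "(\<mu>, \<phi>, locks M m \<Delta>) \<in> locked_hyps M (cat (Ext \<Gamma> \<mu> \<phi>) \<Delta>)"
    using locked_hyps_cat_Ext by (metis modality_def)
  with var.prems obtain \<kappa> \<beta>
    where "(\<mu>, \<phi>, \<kappa>) \<in> locked_hyps M \<Gamma>'" "transformation M \<beta> (locks M m \<Delta>) \<kappa>"
    by (rule ctx_leE)
  moreover from this(2) have "transformation M (\<beta> \<cdot> \<alpha>) \<mu> \<kappa>"
    using var.hyps vcomp_transformation by blast
  ultimately show ?case using ctx_le_imp_ctx(2)[OF var.prems] derivable_locked_hyp by blast
next
  case (OrE \<Gamma> \<phi> \<psi> m \<chi>)
  from OrE.IH(1)[OF OrE.prems] show ?case
    by (rule derivable.OrE)
      (intro OrE.IH(2,3) ctx_le_Ext OrE.prems OrE.hyps(2,3)[THEN derivable_imp_ctx])+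
next
  case (ImpI \<Gamma> \<mu> \<phi> \<psi> m)
  then show ?case by (blast intro: derivable.ImpI ctx_le_Ext derivable_imp_ctx)
next
  case (ImpE \<mu> n m \<Gamma> \<phi> \<psi>)
  then show ?case by (blast intro: derivable.ImpE ctx_le_Lock)
next
  case (ModI \<mu> n m \<Gamma> \<phi>)
  then show ?case by (blast intro: derivable.ModI ctx_le_Lock)
next
  case (ModE \<nu> o' n \<mu> m \<Gamma> \<phi> \<psi>)
  then show ?case by (blast intro: derivable.ModE ctx_le_Lock ctx_le_Ext derivable_imp_ctx)
qed (blast intro: derivable.TopI derivable.BotE derivable.AndI derivable.AndE1 derivable.AndE2
    derivable.OrI1 derivable.OrI2 ctx_le_imp_ctx)+

end

theorem theorem2:
  fixes M :: "('o, 'm, 't) mode_theory"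
    and \<Gamma> \<Delta> :: "'m prectx" and \<mu> \<nu> :: 'm and \<alpha> :: 't and n m p :: 'o and \<phi> :: "'m form"
  assumes "strict_two_category M"
    and "modality M \<mu> n m" and "modality M \<nu> n m"
    and "transformation M \<alpha> \<mu> \<nu>"
    and "derivable M (cat (Lock \<Gamma> \<mu>) \<Delta>) \<phi> p"
  shows "derivable M (cat (Lock \<Gamma> \<nu>) \<Delta>) \<phi> p"
proof -
  interpret strict_two_category M by fact
  have "ctx_le M (Lock \<Gamma> \<mu>) (Lock \<Gamma> \<nu>) q" if "ctx M (Lock \<Gamma> \<mu>) q" for q
    using assms(4) that by (rule ctx_le_Lock_transformation)
  then have "ctx_le M (cat (Lock \<Gamma> \<mu>) \<Delta>) (cat (Lock \<Gamma> \<nu>) \<Delta>) p"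
    using derivable_imp_ctx[OF assms(5)] by (rule ctx_le_cat)
  with assms(5) show ?thesis by (rule derivable_mono)
qed

end
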